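(* Let $\nu$ be a random variable with values in $\mathbb{N}=\{1,2,\dots\}$ such that $\mathbf{P}(\nu=j)>0$ for all $j\ge 1$, let $F(j)=\mathbf{P}(\nu\le j)$, and let $\{X_n\}$ be the Lamperti maximal branching process with branching number $\nu$, with transition matrix $P(i,j)=F(j)^i-F(j-1)^i$, $i,j\ge 1$. Then the Markov chain $\{X_n\}$ is failure-rate monotone, i.e. the cumulated transition matrix $P^c(i,j)=\sum_{k=1}^{j}P(i,k)$ satisfies $$P^{c}(i_1,j_1)\,P^{c}(i_2,j_2)\ \ge\ P^{c}(i_1,j_2)\,P^{c}(i_2,j_1)$$ for all $i_1<i_2$ and $j_1<j_2$ in $\mathbb{N}$.
   Context: The Lamperti maximal branching process with branching number $\nu$ is the Markov chain on $\mathbb{N}=\{1,2,\dots\}$ defined by $X_{n+1}=\max_{j=1,\dots,X_n}\nu_{j,n+1}$, where the $\nu_{j,n+1}$ are i.i.d. copies of $\nu$ (independent of the past). Its transition matrix is $P(i,j)=F(j)^i-F(j-1)^i$, $i,j\ge1$, with $F(0)=0$. A Markov chain on a totally ordered countable state space is called failure-rate monotone if its cumulated transition matrix $P^c(i,j)=\mathbf{P}(X_{n+1}\le j\mid X_n=i)$ is totally positive of order 2, i.e. satisfies the displayed inequality. *)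

theory Defs
  imports "HOL-Probability.Probability"
begin

text \<open>
  A time-homogeneous Markov chain with state space \<open>S\<close> and transition matrix \<open>P\<close>; the
  initial distribution is arbitrary. The Markov property is only required given histories of
  positive probability, since \<open>cond_prob\<close> is \<open>0\<close> by convention when conditioning on a null event.
\<close>

definition markov_chain ::
  "'a measure \<Rightarrow> 's set \<Rightarrow> (nat \<Rightarrow> 'a \<Rightarrow> 's) \<Rightarrow> ('s \<Rightarrow> 's \<Rightarrow> real) \<Rightarrow> bool" where
  "markov_chain M S X P \<longleftrightarrow>
     prob_space M \<and> countable S \<and>
     (\<forall>n. X n \<in> M \<rightarrow>\<^sub>M count_space S) \<and>
     (\<forall>i\<in>S. (\<forall>j\<in>S. 0 \<le> P i j) \<and> (P i has_sum 1) S) \<and>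
     (\<forall>n x. \<forall>j\<in>S. (\<forall>k\<le>n. x k \<in> S) \<longrightarrow>
        0 < \<P>(\<omega> in M. \<forall>k\<le>n. X k \<omega> = x k) \<longrightarrow>
        \<P>(\<omega> in M. X (Suc n) \<omega> = j \<bar> \<forall>k\<le>n. X k \<omega> = x k) = P (x n) j)"

definition cumulated ::
  "'s::linorder set \<Rightarrow> ('s \<Rightarrow> 's \<Rightarrow> real) \<Rightarrow> 's \<Rightarrow> 's \<Rightarrow> real" where
  "cumulated S P i j = (\<Sum>\<^sub>\<infinity>k\<in>{k\<in>S. k \<le> j}. P i k)"

definition TP2_on :: "'s::linorder set \<Rightarrow> ('s \<Rightarrow> 's \<Rightarrow> real) \<Rightarrow> bool" where
  "TP2_on S K \<longleftrightarrow>
     (\<forall>i1\<in>S. \<forall>i2\<in>S. \<forall>j1\<in>S. \<forall>j2\<in>S. i1 < i2 \<longrightarrow> j1 < j2 \<longrightarrow>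
        K i1 j1 * K i2 j2 \<ge> K i1 j2 * K i2 j1)"

definition failure_rate_monotone ::
  "'a measure \<Rightarrow> 's::linorder set \<Rightarrow> (nat \<Rightarrow> 'a \<Rightarrow> 's) \<Rightarrow> ('s \<Rightarrow> 's \<Rightarrow> real) \<Rightarrow> bool" where
  "failure_rate_monotone M S X P \<longleftrightarrow> markov_chain M S X P \<and> TP2_on S (cumulated S P)"

text \<open>
  The Lamperti maximal branching process \<open>X\<close> with branching number \<open>\<nu>\<close> (a positive-integer valued
  random variable on its own probability space \<open>N\<close>). The copies \<open>\<xi> j n\<close> of \<open>\<nu>\<close> are
  used for \<open>j, n \<ge> 1\<close> only. Those with time index \<open>Suc n\<close> are, as a family, independent of the
  past \<open>X 0, \<dots>, X n\<close>.
\<close>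

definition lamperti_process ::
  "'b measure \<Rightarrow> ('b \<Rightarrow> nat) \<Rightarrow> 'a measure \<Rightarrow> (nat \<Rightarrow> nat \<Rightarrow> 'a \<Rightarrow> nat) \<Rightarrow> (nat \<Rightarrow> 'a \<Rightarrow> nat) \<Rightarrow> bool" where
  "lamperti_process N \<nu> M \<xi> X \<longleftrightarrow>
     prob_space N \<and> \<nu> \<in> N \<rightarrow>\<^sub>M count_space {1..} \<and>
     prob_space M \<and> X 0 \<in> M \<rightarrow>\<^sub>M count_space {1..} \<and>
     prob_space.indep_vars M (\<lambda>_. count_space {1..}) (\<lambda>(j, n). \<xi> j n) ({1..} \<times> {1..}) \<and>
     (\<forall>j\<ge>1. \<forall>n\<ge>1. distr M (count_space {1..}) (\<xi> j n) = distr N (count_space {1..}) \<nu>) \<and>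
     (\<forall>n. prob_space.indep_var M
        (PiM {..n} (\<lambda>_. count_space {1..})) (\<lambda>\<omega>. \<lambda>k\<in>{..n}. X k \<omega>)
        (PiM {1..} (\<lambda>_. count_space {1..})) (\<lambda>\<omega>. \<lambda>j\<in>{1..}. \<xi> j (Suc n) \<omega>)) \<and>
     (\<forall>n. \<forall>\<omega>\<in>space M. X (Suc n) \<omega> = Max ((\<lambda>j. \<xi> j (Suc n) \<omega>) ` {1..X n \<omega>}))"

definition dist_fun :: "'b measure \<Rightarrow> ('b \<Rightarrow> nat) \<Rightarrow> nat \<Rightarrow> real" where
  "dist_fun N \<nu> j = \<P>(\<omega> in N. \<nu> \<omega> \<le> j)"

text \<open>Only meaningful for indices \<open>i, j \<ge> 1\<close>; \<open>j - 1\<close> is subtraction on \<^typ>\<open>nat\<close>.\<close>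

definition lamperti_matrix :: "(nat \<Rightarrow> real) \<Rightarrow> nat \<Rightarrow> nat \<Rightarrow> real" where
  "lamperti_matrix F i j = F j ^ i - F (j - 1) ^ i"

end

theory Submission
  imports Defs
begin

text \<open>
  Given \<open>X n = i\<close>, the next state is the maximum of \<open>i\<close> fresh copies of \<open>\<nu>\<close>, so it is at most \<open>j\<close>
  with probability \<open>F j ^ i\<close>; this is the telescoped sum of the row \<open>P i\<close>. As \<open>F\<close> is nonnegative
  and increasing, total positivity reduces to \<open>F j1 ^ (i2 - i1) \<le> F j2 ^ (i2 - i1)\<close>.
\<close>

section \<open>An inequality between powers\<close>

lemma power_mult_power_le_swap:
  fixes a b :: real
  assumes "0 \<le> a" "a \<le> b" "m \<le> n"
  shows "b ^ m * a ^ n \<le> a ^ m * b ^ n"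
proof -
  \<comment> \<open>Both products contain the factor \<open>(a * b) ^ m\<close>; splitting it off
    rather than dividing by powers also covers \<open>a = 0\<close>.\<close>
  have "(a * b) ^ m * a ^ (n - m) \<le> (a * b) ^ m * b ^ (n - m)"
    using assms by (intro mult_left_mono power_mono) auto
  moreover have "a ^ n = a ^ m * a ^ (n - m)" "b ^ n = b ^ m * b ^ (n - m)"
    using assms(3) by (simp_all flip: power_add)
  ultimately show ?thesis
    by (simp add: power_mult_distrib ac_simps)
qed

lemma dist_fun_nonneg: "0 \<le> dist_fun N \<nu> j"
  by (simp add: dist_fun_def)

section \<open>Distribution function and transition matrix of the branching number\<close>

context
  fixes N :: "'b measure" and \<nu> :: "'b \<Rightarrow> nat"
  assumes prob_N: "prob_space N" and meas_nu: "\<nu> \<in> N \<rightarrow>\<^sub>M count_space {1..}"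
begin

interpretation N: prob_space N by (fact prob_N)

lemma dist_fun_sets: "{\<omega> \<in> space N. \<nu> \<omega> \<le> j} \<in> sets N"
proof -
  have "\<nu> -` {1..j} \<inter> space N \<in> sets N"
    by (rule measurable_sets[OF meas_nu]) auto
  also have "\<nu> -` {1..j} \<inter> space N = {\<omega> \<in> space N. \<nu> \<omega> \<le> j}"
    using measurable_space[OF meas_nu] by auto
  finally show ?thesis .
qed

lemma dist_fun_mono: "i \<le> j \<Longrightarrow> dist_fun N \<nu> i \<le> dist_fun N \<nu> j"
  unfolding dist_fun_def by (intro N.finite_measure_mono dist_fun_sets) auto

lemma dist_fun_0: "dist_fun N \<nu> 0 = 0"
proof -
  have "{\<omega> \<in> space N. \<nu> \<omega> \<le> 0} = {}"
    using measurable_space[OF meas_nu] by fastforce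
  then show ?thesis unfolding dist_fun_def by (simp only: measure_empty)
qed

lemma dist_fun_tendsto_1: "dist_fun N \<nu> \<longlonglongrightarrow> 1"
proof -
  have "(\<lambda>j. N.prob {\<omega> \<in> space N. \<nu> \<omega> \<le> j})
          \<longlonglongrightarrow> N.prob (\<Union>j. {\<omega> \<in> space N. \<nu> \<omega> \<le> j})"
    by (rule N.finite_Lim_measure_incseq) (auto intro: dist_fun_sets incseq_SucI)
  also have "(\<Union>j. {\<omega> \<in> space N. \<nu> \<omega> \<le> j}) = space N" by auto
  finally show ?thesis by (simp add: N.prob_space dist_fun_def[abs_def])
qed

lemma lamperti_matrix_nonneg: "0 \<le> lamperti_matrix (dist_fun N \<nu>) i j"
  unfolding lamperti_matrix_def by (simp add: power_mono dist_fun_mono dist_fun_nonneg)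

text \<open>Telescoping leaves \<open>F j ^ i - F 0 ^ i\<close>; the last term vanishes because
  \<open>F 0 = 0\<close> and the exponent is positive.\<close>

lemma sum_lamperti_matrix:
  assumes "1 \<le> i"
  shows "(\<Sum>k=1..j. lamperti_matrix (dist_fun N \<nu>) i k) = dist_fun N \<nu> j ^ i"
  using assms by (induction j) (simp_all add: lamperti_matrix_def dist_fun_0)

lemma has_sum_lamperti_matrix:
  assumes i: "1 \<le> i"
  shows "(lamperti_matrix (dist_fun N \<nu>) i has_sum 1) {1..}"
proof -
  let ?P = "lamperti_matrix (dist_fun N \<nu>) i"
  have "(\<lambda>j. dist_fun N \<nu> j ^ i) \<longlonglongrightarrow> 1 ^ i"
    by (intro tendsto_power dist_fun_tendsto_1)
  \<comment> \<open>The index is shifted by \<open>Suc\<close> because \<open>sums\<close> counts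
    from 0 while the states start at 1.\<close>
  then have "(\<lambda>j. \<Sum>k<j. ?P (Suc k)) \<longlonglongrightarrow> 1"
    using sum_lamperti_matrix[OF i]
    by (simp add: sum.atLeast1_atMost_eq)
  then have "(\<lambda>k. ?P (Suc k)) sums 1" by (simp add: sums_def)
  \<comment> \<open>Nonnegative terms upgrade convergence in order to the unordered summability that
    \<open>markov_chain\<close> asks for.\<close>
  then have "((\<lambda>k. ?P (Suc k)) has_sum 1) UNIV"
    by (intro sums_nonneg_imp_has_sum) (auto simp: lamperti_matrix_nonneg)
  then have "((?P \<circ> Suc) has_sum 1) UNIV" by (simp add: o_def)
  then have "(?P has_sum 1) (range Suc)"
    by (subst has_sum_reindex) auto
  also have "range Suc = {1..}"
    using greaterThan_0 by (simp add: atLeast_Suc_greaterThan)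
  finally show ?thesis .
qed

lemma cumulated_lamperti_matrix:
  assumes "1 \<le> i"
  shows "cumulated {1..} (lamperti_matrix (dist_fun N \<nu>)) i j = dist_fun N \<nu> j ^ i"
proof -
  have "{k \<in> {1..}. k \<le> j} = {1..j}" by auto
  then show ?thesis
    using sum_lamperti_matrix[OF assms] by (simp add: cumulated_def)
qed

lemma TP2_on_cumulated_lamperti_matrix:
  "TP2_on {1..} (cumulated {1..} (lamperti_matrix (dist_fun N \<nu>)))"
  unfolding TP2_on_def
  \<comment> \<open>The power inequality is applied with \<open>a = F j1\<close>,
    \<open>b = F j2\<close>, \<open>m = i1\<close>, \<open>n = i2\<close>.\<close>
  by (auto simp del: One_nat_def simp: cumulated_lamperti_matrix
      intro!: power_mult_power_le_swap dist_fun_nonneg dist_fun_mono)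

end

section \<open>The Markov property of the maximal branching process\<close>

context
  fixes N :: "'b measure" and \<nu> :: "'b \<Rightarrow> nat"
    and M :: "'a measure" and \<xi> :: "nat \<Rightarrow> nat \<Rightarrow> 'a \<Rightarrow> nat" and X :: "nat \<Rightarrow> 'a \<Rightarrow> nat"
  assumes lamperti: "lamperti_process N \<nu> M \<xi> X"
begin

lemma prob_N: "prob_space N" and meas_nu: "\<nu> \<in> N \<rightarrow>\<^sub>M count_space {1..}"
  and prob_M: "prob_space M"
  using lamperti by (auto simp: lamperti_process_def)

interpretation M: prob_space M by (fact prob_M)

lemma indep_copies:
  "M.indep_vars (\<lambda>_. count_space {1..}) (\<lambda>(j, n). \<xi> j n) ({1..} \<times> {1..})"
  and distr_copy: "1 \<le> j \<Longrightarrow> 1 \<le> n \<Longrightarrow>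
    distr M (count_space {1..}) (\<xi> j n) = distr N (count_space {1..}) \<nu>"
  and indep_past: "M.indep_var
        (PiM {..n} (\<lambda>_. count_space {1..})) (\<lambda>\<omega>. \<lambda>k\<in>{..n}. X k \<omega>)
        (PiM {1..} (\<lambda>_. count_space {1..})) (\<lambda>\<omega>. \<lambda>j\<in>{1..}. \<xi> j (Suc n) \<omega>)"
  and X_Suc: "\<omega> \<in> space M \<Longrightarrow>
    X (Suc n) \<omega> = Max ((\<lambda>j. \<xi> j (Suc n) \<omega>) ` {1..X n \<omega>})"
  using lamperti by (auto simp: lamperti_process_def)

text \<open>For positive \<open>n\<close> the measurability is read off the independence assumption,
  which makes the whole past a random variable; projecting to coordinate \<open>n\<close> gives
  \<open>X n\<close>.\<close>

lemma measurable_X: "X n \<in> M \<rightarrow>\<^sub>M count_space {1..}"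
proof -
  have "(\<lambda>\<omega>. \<lambda>k\<in>{..n}. X k \<omega>) \<in> M \<rightarrow>\<^sub>M PiM {..n} (\<lambda>_. count_space {1..})"
    using indep_past by (rule M.indep_var_rv1)
  then have "(\<lambda>\<omega>. (\<lambda>k\<in>{..n}. X k \<omega>) n) \<in> M \<rightarrow>\<^sub>M count_space {1..}"
    by (rule measurable_compose) (rule measurable_component_singleton, simp)
  then show ?thesis by simp
qed

lemma measurable_copy:
  assumes "1 \<le> j" "1 \<le> n"
  shows "\<xi> j n \<in> M \<rightarrow>\<^sub>M count_space {1..}"
  using indep_copies assms unfolding M.indep_vars_def by auto

lemma prob_copy_le:
  assumes "1 \<le> j" "1 \<le> n"
  shows "M.prob (\<xi> j n -` {1..m} \<inter> space M) = dist_fun N \<nu> m"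
proof -
  have "M.prob (\<xi> j n -` {1..m} \<inter> space M) = measure (distr M (count_space {1..}) (\<xi> j n)) {1..m}"
    by (rule measure_distr[symmetric, OF measurable_copy[OF assms]]) auto
  also have "\<dots> = measure N (\<nu> -` {1..m} \<inter> space N)"
    unfolding distr_copy[OF assms] by (rule measure_distr[OF meas_nu]) auto
  also have "\<nu> -` {1..m} \<inter> space N = {\<omega> \<in> space N. \<nu> \<omega> \<le> m}"
    using measurable_space[OF meas_nu] by auto
  finally show ?thesis by (simp add: dist_fun_def)
qed

lemma prob_copies_le:
  assumes "1 \<le> i" "1 \<le> n"
  shows "\<P>(\<omega> in M. \<forall>l\<in>{1..i}. \<xi> l n \<omega> \<le> m) = dist_fun N \<nu> m ^ i"
proof -
  \<comment> \<open>The product rule for independent events is used on this finite subfamily of the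
    copies; it is nonempty because \<open>1 \<le> i\<close>.\<close>
  let ?J = "(\<lambda>l. (l, n)) ` {1..i}"
  have "M.prob (\<Inter>p\<in>?J. (case p of (l, n) \<Rightarrow> \<xi> l n) -` {1..m} \<inter> space M)
      = (\<Prod>p\<in>?J. M.prob ((case p of (l, n) \<Rightarrow> \<xi> l n) -` {1..m} \<inter> space M))"
    by (rule M.indep_varsD[OF indep_copies]) (use assms in auto)
  also have "\<dots> = (\<Prod>l\<in>{1..i}. M.prob (\<xi> l n -` {1..m} \<inter> space M))"
    by (subst prod.reindex) (auto intro: inj_onI)
  also have "\<dots> = dist_fun N \<nu> m ^ i"
    using assms by (simp add: prob_copy_le del: One_nat_def)
  also have "(\<Inter>p\<in>?J. (case p of (l, n) \<Rightarrow> \<xi> l n) -` {1..m} \<inter> space M)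
      = {\<omega> \<in> space M. \<forall>l\<in>{1..i}. \<xi> l n \<omega> \<le> m}"
  proof -
    have "1 \<le> \<xi> l n \<omega>" if "1 \<le> l" "\<omega> \<in> space M" for l \<omega>
      using measurable_space[OF measurable_copy[OF that(1) assms(2)] that(2)] by simp
    then show ?thesis using assms by (auto 4 3)
  qed
  finally show ?thesis .
qed

text \<open>Once the history fixes \<open>X n = x n\<close>, the maximum runs over a deterministic
  number of copies. The event for the next state then concerns the new copies alone, so independence
  from the past factors the probability.\<close>

lemma prob_past_and_next_le:
  assumes x: "\<forall>k\<le>n. x k \<in> {1..}"
  shows "\<P>(\<omega> in M. X (Suc n) \<omega> \<le> m \<and> (\<forall>k\<le>n. X k \<omega> = x k))
    = \<P>(\<omega> in M. \<forall>k\<le>n. X k \<omega> = x k) * dist_fun N \<nu> m ^ x n"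
proof -
  let ?S = "PiM {..n} (\<lambda>_. count_space {1::nat..})"
  let ?T = "PiM {1::nat..} (\<lambda>_. count_space {1::nat..})"
  let ?past = "\<lambda>\<omega>. \<lambda>k\<in>{..n}. X k \<omega>"
  let ?new = "\<lambda>\<omega>. \<lambda>j\<in>{1..}. \<xi> j (Suc n) \<omega>"
  \<comment> \<open>\<open>A\<close> holds the single prescribed history. \<open>B\<close>
    constrains only the first \<open>x n\<close> coordinates of an infinite product, which makes it
    measurable.\<close>
  define A where "A = PiE {..n} (\<lambda>k. {x k})"
  define B where "B = {g \<in> space ?T. \<forall>l\<in>{1..x n}. g l \<in> {1..m}}"
  have xn: "1 \<le> x n" using x by auto
  have A: "A \<in> sets ?S"
    unfolding A_def using x by (intro sets_PiM_I_finite) auto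
  have "{g \<in> space ?T. g l \<in> {1..m}} \<in> sets ?T" if "l \<in> {1..x n}" for l
  proof -
    have "(\<lambda>g. g l) -` {1..m} \<inter> space ?T \<in> sets ?T"
      by (rule measurable_sets[OF measurable_component_singleton]) (use that in auto)
    also have "(\<lambda>g. g l) -` {1..m} \<inter> space ?T = {g \<in> space ?T. g l \<in> {1..m}}"
      by blast
    finally show ?thesis .
  qed
  then have B: "B \<in> sets ?T"
    unfolding B_def by (intro sets.sets_Collect_finite_All) auto
  have past: "?past \<omega> \<in> A \<longleftrightarrow> (\<forall>k\<le>n. X k \<omega> = x k)" for \<omega>
    by (auto simp: A_def PiE_iff)
  have new: "?new \<omega> \<in> B \<longleftrightarrow> (\<forall>l\<in>{1..x n}. \<xi> l (Suc n) \<omega> \<le> m)" if "\<omega> \<in> space M" for \<omega>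
  proof -
    have "?new \<omega> \<in> space ?T" "1 \<le> l \<Longrightarrow> 1 \<le> \<xi> l (Suc n) \<omega>" for l
      using measurable_space[OF measurable_copy that] by (auto simp: space_PiM PiE_iff)
    then show ?thesis by (auto simp: B_def)
  qed
  \<comment> \<open>\<open>1 \<le> x n\<close> keeps the set under \<open>Max\<close>
    nonempty.\<close>
  have next_le: "X (Suc n) \<omega> \<le> m \<longleftrightarrow> (\<forall>l\<in>{1..x n}. \<xi> l (Suc n) \<omega> \<le> m)"
    if "\<omega> \<in> space M" "X n \<omega> = x n" for \<omega>
    using xn by (subst X_Suc[OF that(1)], subst Max_le_iff) (auto simp: that(2))
  \<comment> \<open>\<open>next_le\<close> applies because the history clause at
    \<open>k = n\<close> gives \<open>X n \<omega> = x n\<close>.\<close>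
  have "{\<omega> \<in> space M. X (Suc n) \<omega> \<le> m \<and> (\<forall>k\<le>n. X k \<omega> = x k)}
      = (\<lambda>\<omega>. (?past \<omega>, ?new \<omega>)) -` (A \<times> B) \<inter> space M"
    using next_le new past by auto
  also have "M.prob \<dots> = M.prob (?past -` A \<inter> space M) * M.prob (?new -` B \<inter> space M)"
    by (rule M.indep_varD[OF indep_past A B])
  also have "?past -` A \<inter> space M = {\<omega> \<in> space M. \<forall>k\<le>n. X k \<omega> = x k}"
    using past by auto
  also have "?new -` B \<inter> space M = {\<omega> \<in> space M. \<forall>l\<in>{1..x n}. \<xi> l (Suc n) \<omega> \<le> m}"
    using new by auto
  also have "M.prob \<dots> = dist_fun N \<nu> m ^ x n"
    using xn by (intro prob_copies_le) auto
  finally show ?thesis .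
qed

lemma prob_past_and_next_eq:
  assumes x: "\<forall>k\<le>n. x k \<in> {1..}" and j: "1 \<le> j"
  shows "\<P>(\<omega> in M. X (Suc n) \<omega> = j \<and> (\<forall>k\<le>n. X k \<omega> = x k))
    = \<P>(\<omega> in M. \<forall>k\<le>n. X k \<omega> = x k) * lamperti_matrix (dist_fun N \<nu>) (x n) j"
proof -
  let ?E = "\<lambda>m. {\<omega> \<in> space M. X (Suc n) \<omega> \<le> m \<and> (\<forall>k\<le>n. X k \<omega> = x k)}"
  \<comment> \<open>The target is widened to all naturals so that events comparing
    \<open>X k\<close> with arbitrary numbers are measurable.\<close>
  have [measurable]: "X k \<in> M \<rightarrow>\<^sub>M count_space UNIV" for k
    using measurable_compose[OF measurable_X, of "\<lambda>i. i"] by simp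
  have E: "?E m \<in> sets M" for m
    by measurable
  \<comment> \<open>\<open>1 \<le> j\<close> matters: the subtraction is truncated, and at
    \<open>j = 0\<close> both events would coincide.\<close>
  have diff: "{\<omega> \<in> space M. X (Suc n) \<omega> = j \<and> (\<forall>k\<le>n. X k \<omega> = x k)} = ?E j - ?E (j - 1)"
    using j by auto
  have "M.prob (?E j - ?E (j - 1)) = M.prob (?E j) - M.prob (?E (j - 1))"
    by (rule M.finite_measure_Diff[OF E E]) auto
  then show ?thesis
    unfolding diff by (simp only: prob_past_and_next_le[OF x] lamperti_matrix_def right_diff_distrib)
qed

lemma markov_chain_lamperti: "markov_chain M {1..} X (lamperti_matrix (dist_fun N \<nu>))"
  unfolding markov_chain_def
proof (intro conjI allI ballI impI)
  fix n j :: nat and x :: "nat \<Rightarrow> nat"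
  assume "j \<in> {1..}" "\<forall>k\<le>n. x k \<in> {1..}" "0 < \<P>(\<omega> in M. \<forall>k\<le>n. X k \<omega> = x k)"
  \<comment> \<open>The joint probability is divided by that of the history, which is positive here;
    the quotient depends on the history only through \<open>x n\<close>.\<close>
  then show "\<P>(\<omega> in M. X (Suc n) \<omega> = j \<bar> \<forall>k\<le>n. X k \<omega> = x k)
      = lamperti_matrix (dist_fun N \<nu>) (x n) j"
    using prob_past_and_next_eq[of n x j] by (simp add: cond_prob_def)
qed (simp_all del: One_nat_def add: prob_M measurable_X
    lamperti_matrix_nonneg[OF prob_N meas_nu] has_sum_lamperti_matrix[OF prob_N meas_nu])

end

theorem proposition1:
  fixes N :: "'b measure" and \<nu> :: "'b \<Rightarrow> nat"
    and M :: "'a measure" and \<xi> :: "nat \<Rightarrow> nat \<Rightarrow> 'a \<Rightarrow> nat" and X :: "nat \<Rightarrow> 'a \<Rightarrow> nat"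
    and F :: "nat \<Rightarrow> real" and P :: "nat \<Rightarrow> nat \<Rightarrow> real"
  assumes "lamperti_process N \<nu> M \<xi> X"
    and "\<forall>j\<ge>1. \<P>(\<omega> in N. \<nu> \<omega> = j) > 0"
    and "F = dist_fun N \<nu>"
    and "P = lamperti_matrix F"
  shows "failure_rate_monotone M {1..} X P \<and>
    (\<forall>i1\<ge>1. \<forall>i2\<ge>1. \<forall>j1\<ge>1. \<forall>j2\<ge>1. i1 < i2 \<longrightarrow> j1 < j2 \<longrightarrow>
       (\<Sum>k=1..j1. P i1 k) * (\<Sum>k=1..j2. P i2 k) \<ge> (\<Sum>k=1..j2. P i1 k) * (\<Sum>k=1..j1. P i2 k))"
proof -
  have N: "prob_space N" "\<nu> \<in> N \<rightarrow>\<^sub>M count_space {1..}"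
    using assms(1) by (auto simp: lamperti_process_def)
  \<comment> \<open>In the explicit inequality the finite sums also collapse to powers of
    \<open>F\<close>, so the same power inequality settles it.\<close>
  show ?thesis
    unfolding failure_rate_monotone_def assms(3,4)
    using markov_chain_lamperti[OF assms(1)] TP2_on_cumulated_lamperti_matrix[OF N]
    by (auto simp: sum_lamperti_matrix[OF N] simp del: One_nat_def
        intro!: power_mult_power_le_swap dist_fun_nonneg dist_fun_mono[OF N])
qed

end
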